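(* Let $T$ be a tree of arbitrary degree and $T'$ its ternarization. For vertices $u,v,r$ of $T$, the owner of $LCA_{T'}(u,v,r)$ equals $LCA_T(u,v,r)$.
   Context: The ternarization $T'$ of $T$ is a tree of maximum degree 3 obtained by replacing each vertex $v$ of $T$ by a chain (path) consisting of $v$ itself and dummy vertices whose owner is $v$ (the owner of $v$ itself is $v$), consecutive chain vertices joined by edges, and replacing each edge $(v,w)$ of $T$ by an edge between a vertex of the chain of $v$ and a vertex of the chain of $w$ (each chain vertex attached to at most one such original edge). For an unrooted tree and vertices $a,b,r$, $a$ is an ancestor of $b$ with respect to root $r$ if $a$ lies on the unique path from $b$ to $r$ (a vertex is its own ancestor); $LCA(u,v,r)$ is the vertex $c$ that is a common ancestor of $u$ and $v$ with respect to $r$ such that every common ancestor of $u$ and $v$ is an ancestor of $c$ (equivalently, the unique vertex minimizing the sum of unweighted distances to $u$, $v$ and $r$). *)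

theory Defs
  imports "Graph_Theory.Graph_Theory"
begin

(* A simple undirected graph is a pair_graph: finite, loop-free, with a symmetric arc set.
   The constant Digraph_Component.tree is not usable here: it forbids the closed walk
   [(u, v), (v, u)], so no symmetric digraph with an arc satisfies it, while an acyclically
   oriented triangle does.  A cycle of an undirected graph has length at least 3. *)

definition undirected_tree :: "'a pair_pre_digraph \<Rightarrow> bool" where
  "undirected_tree G \<longleftrightarrow>
     pair_graph G \<and> connected (with_proj G) \<and>
     \<not> (\<exists>p. pre_digraph.cycle (with_proj G) p \<and> 3 \<le> length p)"

definition tree_path :: "'a pair_pre_digraph \<Rightarrow> 'a \<Rightarrow> 'a \<Rightarrow> 'a vwalk" where
  "tree_path G x y = (THE p. vpath p (with_proj G) \<and> hd p = x \<and> last p = y)"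

definition ancestor :: "'a pair_pre_digraph \<Rightarrow> 'a \<Rightarrow> 'a \<Rightarrow> 'a \<Rightarrow> bool" where
  "ancestor G r a b \<longleftrightarrow> a \<in> set (tree_path G b r)"

definition common_ancestor :: "'a pair_pre_digraph \<Rightarrow> 'a \<Rightarrow> 'a \<Rightarrow> 'a \<Rightarrow> 'a \<Rightarrow> bool" where
  "common_ancestor G r a u v \<longleftrightarrow> ancestor G r a u \<and> ancestor G r a v"

definition LCA :: "'a pair_pre_digraph \<Rightarrow> 'a \<Rightarrow> 'a \<Rightarrow> 'a \<Rightarrow> 'a" where
  "LCA G u v r =
     (THE c. common_ancestor G r c u v \<and> (\<forall>a. common_ancestor G r a u v \<longrightarrow> ancestor G r a c))"

(* chain v lists the path that replaces v, with v itself at an arbitrary position; att v w is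
   the vertex of the chain of v that carries the edge between v and w.  The condition on owner
   makes chains of distinct vertices disjoint; hence the vertices of chain v other than v are
   dummies, i.e. not vertices of T.  Injectivity of att v says that each chain vertex carries
   at most one original edge. *)

definition ternarization ::
  "'a pair_pre_digraph \<Rightarrow> 'a pair_pre_digraph \<Rightarrow> ('a \<Rightarrow> 'a) \<Rightarrow> bool" where
  "ternarization T T' owner \<longleftrightarrow>
     undirected_tree T' \<and>
     (\<forall>x \<in> pverts T'. out_degree (with_proj T') x \<le> 3) \<and>
     (\<exists>(chain :: 'a \<Rightarrow> 'a list) (att :: 'a \<Rightarrow> 'a \<Rightarrow> 'a).
        (\<forall>v \<in> pverts T. distinct (chain v) \<and> v \<in> set (chain v) \<and>
           (\<forall>x \<in> set (chain v). owner x = v)) \<and>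
        (\<forall>v \<in> pverts T. inj_on (att v) {w. (v, w) \<in> parcs T}) \<and>
        (\<forall>v w. (v, w) \<in> parcs T \<longrightarrow> att v w \<in> set (chain v)) \<and>
        pverts T' = (\<Union>v \<in> pverts T. set (chain v)) \<and>
        parcs T' = (\<Union>v \<in> pverts T. symcl (set (vwalk_arcs (chain v)))) \<union>
                   {(att v w, att w v) | v w. (v, w) \<in> parcs T})"

end

theory Submission
  imports Defs
begin

(* Paths of T' project to paths of T.  The subpath of a chain between two of its vertices is
   the only path of T' between them, so a path of T' that leaves a chain never returns to it;
   deleting repetitions from the list of owners of its vertices therefore leaves a path of T.
   If c is the LCA in T', the paths from u and v to r meet exactly from c on.  A common ancestor
   a of u and v in T owns a vertex on each of them.  If neither of these two vertices lies on the
   path from c to r, they are joined by a path of T' through c, hence a owns c as well. *)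

section \<open>Walks and paths as vertex lists\<close>

lemma vwalk_singleton_iff [simp]: "vwalk [x] G \<longleftrightarrow> x \<in> verts G"
  by (auto simp: vwalk_def)

lemma vwalk_Cons_iff:
  assumes "p \<noteq> []"
  shows "vwalk (x # p) G \<longleftrightarrow> x \<in> verts G \<and> (x, hd p) \<in> arcs_ends G \<and> vwalk p G"
  using assms by (auto simp: vwalk_def)

lemma vwalk_append_iff:
  assumes "p \<noteq> []" and "q \<noteq> []"
  shows "vwalk (p @ q) G \<longleftrightarrow> vwalk p G \<and> vwalk q G \<and> (last p, hd q) \<in> arcs_ends G"
  using assms by (auto simp: vwalk_def vwalk_arcs_append)

lemma vwalk_rev:
  assumes "symmetric G" and "vwalk p G"
  shows "vwalk (rev p) G"
  using assms arcs_ends_symmetric[OF assms(1)]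
  by (auto simp: vwalk_def set_vwalk_arcs_rev)

lemma vpath_rev:
  assumes "symmetric G" and "vpath p G"
  shows "vpath (rev p) G"
  using assms vwalk_rev by (auto simp: vpath_def)

lemma vpath_appendD:
  assumes "vpath (p @ q) G"
  shows "p \<noteq> [] \<Longrightarrow> vpath p G" and "q \<noteq> [] \<Longrightarrow> vpath q G"
  using assms by (auto simp: vpath_def intro: vwalkI_append_l vwalkI_append_r)

lemma vpath_ConsD: "vpath (x # p) G \<Longrightarrow> p \<noteq> [] \<Longrightarrow> vpath p G"
  using vpath_appendD(2)[of "[x]" p G] by simp

lemma vpath_hd_eq_last:
  assumes "vpath p G" and "hd p = last p"
  shows "tl p = []"
proof (cases p)
  case (Cons x xs)
  then show ?thesis using assms by (cases xs rule: rev_cases) (auto simp: vpath_def)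
qed simp

section \<open>From closed vertex walks to cycles\<close>

lemma awalk_verts_vwalk_arcs:
  assumes "p \<noteq> []"
  shows "pre_digraph.awalk_verts (with_proj G) (hd p) (vwalk_arcs p) = p"
  using assms
  by (induction p rule: vwalk_arcs.induct) (auto simp: pre_digraph.awalk_verts.simps)

lemma cas_vwalk_arcs:
  assumes "p \<noteq> []"
  shows "pre_digraph.cas (with_proj G) (hd p) (vwalk_arcs p) (last p)"
  using assms
  by (induction p rule: vwalk_arcs.induct) (auto simp: pre_digraph.cas.simps)

text \<open>Trees are defined by forbidding cycles given as arc lists, whereas paths are handled as
  vertex lists; this is the bridge. Only the tail of \<open>p\<close> has to be distinct because the
  first vertex returns at the end, and two vertices already make the arc list nonempty.\<close>

lemma cycle_vwalk_arcs:
  assumes "vwalk p (with_proj G)" and "hd p = last p" and "distinct (tl p)" and "2 \<le> length p"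
  shows "pre_digraph.cycle (with_proj G) (vwalk_arcs p)"
proof -
  have "p \<noteq> []" and "hd p \<in> pverts G" and "set (vwalk_arcs p) \<subseteq> parcs G"
    using assms(1) by (auto simp: vwalk_def)
  moreover have "vwalk_arcs p \<noteq> []"
    using vwalk_length_simp[of p] assms(4) unfolding vwalk_length_def by force
  ultimately show ?thesis
    using assms(2,3) awalk_verts_vwalk_arcs[of p G] cas_vwalk_arcs[of p G]
    unfolding pre_digraph.cycle_def pre_digraph.awalk_def by auto
qed

section \<open>Existence and uniqueness of paths in a tree\<close>

lemma undirected_tree_symmetric: "undirected_tree G \<Longrightarrow> symmetric (with_proj G)"
  unfolding undirected_tree_def pair_graph_def pair_pseudo_graph_def pair_sym_digraph_def
    pair_sym_digraph_axioms_def by blast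

text \<open>Strip the common first vertex and induct. If the next vertices differed, going along one
  path to its first meeting with the other and back along the latter would close a cycle.\<close>

lemma undirected_tree_vpath_unique:
  assumes tree: "undirected_tree G"
    and "vpath p (with_proj G)" and "vpath q (with_proj G)"
    and "hd p = hd q" and "last p = last q"
  shows "p = q"
  using assms(2-)
proof (induction p arbitrary: q)
  case Nil
  then show ?case by (auto simp: vpath_def vwalk_def)
next
  case (Cons x p)
  obtain q' where q: "q = x # q'"
    using Cons.prems by (cases q) (auto simp: vpath_def vwalk_def)
  show ?case
  proof (cases "p = [] \<or> q' = []")
    \<comment> \<open>One of the paths is just \<open>x\<close>, so \<open>x\<close> is also the
      common last vertex; a path that starts and ends in the same vertex is trivial.\<close>
    case True
    then have "last (x # p) = x \<or> last q = x" by (auto simp: q)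
    then have "hd (x # p) = last (x # p)" and "hd q = last q"
      using Cons.prems(3,4) by (metis list.sel(1))+
    from vpath_hd_eq_last[OF Cons.prems(1) this(1)] vpath_hd_eq_last[OF Cons.prems(2) this(2)]
    show ?thesis by (simp add: q)
  next
    case False
    then have ne: "p \<noteq> []" "q' \<noteq> []" by auto
    have vp: "vpath p (with_proj G)" and vq: "vpath q' (with_proj G)"
      using Cons.prems ne by (auto simp: q dest: vpath_ConsD)
    have lastpq: "last p = last q'" using Cons.prems ne by (simp add: q)
    have "hd p = hd q'"
    proof (rule ccontr)
      assume neq: "hd p \<noteq> hd q'"
      \<comment> \<open>The tails share at least their last vertex; \<open>z\<close> is the first
        vertex of \<open>p\<close> that lies on \<open>q'\<close>.\<close>
      have "\<exists>z\<in>set p. z \<in> set q'" using lastpq ne by (metis last_in_set)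
      then obtain A z B where p: "p = A @ z # B" and zq: "z \<in> set q'"
        and A: "\<forall>y\<in>set A. y \<notin> set q'"
        by (rule split_list_first_propE)
      obtain C D where q': "q' = C @ z # D" using zq by (metis split_list)
      \<comment> \<open>The closed walk runs from \<open>x\<close> through \<open>A\<close> to
        \<open>z\<close> and returns through \<open>C\<close> reversed to \<open>x\<close>. No
        vertex of \<open>A\<close> lies on \<open>q'\<close>, so only \<open>x\<close> is
        repeated.\<close>
      let ?c = "(x # A @ [z]) @ rev (x # C)"
      have "vpath ((x # A @ [z]) @ B) (with_proj G)" using Cons.prems(1) by (simp add: p)
      from vpath_appendD(1)[OF this] have "vwalk (x # A @ [z]) (with_proj G)"
        by (simp add: vpath_def)
      moreover have "vpath ((x # C) @ z # D) (with_proj G)"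
        using Cons.prems(2) by (simp add: q q')
      then have "vwalk (x # C) (with_proj G)"
        and "(last (x # C), z) \<in> arcs_ends (with_proj G)"
        unfolding vpath_def by (subst (asm) vwalk_append_iff; simp)+
      then have "vwalk (rev (x # C)) (with_proj G)"
        and "(z, hd (rev (x # C))) \<in> arcs_ends (with_proj G)"
        using undirected_tree_symmetric[OF tree] vwalk_rev arcs_ends_symmetric
        by (blast, metis hd_rev)
      ultimately have "vwalk ?c (with_proj G)"
        by (subst vwalk_append_iff) auto
      moreover have "distinct (tl ?c)"
        using Cons.prems(1,2) A by (auto simp: p q q' vpath_def)
      \<comment> \<open>If \<open>A\<close> and \<open>C\<close> were both empty, \<open>z\<close>
        would be the head of both tails. So besides \<open>z\<close> and the two occurrences of
        \<open>x\<close> there is a fourth entry, which gives three arcs and excludes the closed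
        walk that uses one edge back and forth.\<close>
      moreover have len: "4 \<le> length ?c"
        using neq by (cases A; cases C) (auto simp: p q')
      ultimately have "pre_digraph.cycle (with_proj G) (vwalk_arcs ?c)"
        by (intro cycle_vwalk_arcs) auto
      moreover have "3 \<le> length (vwalk_arcs ?c)"
        using vwalk_length_simp[of ?c] len unfolding vwalk_length_def by linarith
      ultimately show False using tree unfolding undirected_tree_def by blast
    qed
    then show ?thesis using Cons.IH[OF vp vq] lastpq by (simp add: q)
  qed
qed

lemma undirected_tree_vpath_exists:
  assumes "undirected_tree G" and "x \<in> pverts G" and "y \<in> pverts G"
  shows "\<exists>p. vpath p (with_proj G) \<and> hd p = x \<and> last p = y"
proof -
  interpret pair_graph G using assms(1) unfolding undirected_tree_def by simp
  \<comment> \<open>Connectedness is stated for the symmetric closure; since the arc set is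
    symmetric already, reachability is the same in the graph itself.\<close>
  have "x \<rightarrow>\<^sup>*\<^bsub>mk_symmetric (with_proj G)\<^esub> y"
    using assms unfolding undirected_tree_def connected_def strongly_connected_def by simp
  then have "x \<rightarrow>\<^sup>*\<^bsub>with_proj G\<^esub> y"
    by (simp add: reachable_mk_symmetric_eq[OF undirected_tree_symmetric[OF assms(1)]])
  then show ?thesis
    by (simp add: reachable_vpath_conv)
qed

lemma tree_path_eqI:
  assumes "undirected_tree G" and "vpath p (with_proj G)" and "hd p = x" and "last p = y"
  shows "tree_path G x y = p"
  unfolding tree_path_def
proof (rule the_equality)
  fix q assume "vpath q (with_proj G) \<and> hd q = x \<and> last q = y"
  then show "q = p" by (intro undirected_tree_vpath_unique[OF assms(1)]) (simp_all add: assms)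
qed (simp add: assms)

lemma tree_path_props:
  assumes "undirected_tree G" and "x \<in> pverts G" and "y \<in> pverts G"
  shows "vpath (tree_path G x y) (with_proj G)"
    and "hd (tree_path G x y) = x" and "last (tree_path G x y) = y"
    and "tree_path G x y \<noteq> []"
proof -
  obtain p where p: "vpath p (with_proj G)" "hd p = x" "last p = y"
    using undirected_tree_vpath_exists[OF assms] by blast
  have "tree_path G x y = p" by (rule tree_path_eqI[OF assms(1) p])
  moreover have "p \<noteq> []" using p(1) by (simp add: vpath_def vwalk_def)
  ultimately show "vpath (tree_path G x y) (with_proj G)"
    and "hd (tree_path G x y) = x" and "last (tree_path G x y) = y"
    and "tree_path G x y \<noteq> []" using p by simp_all
qed

lemma tree_path_in_verts:
  assumes "undirected_tree G" and "x \<in> pverts G" and "y \<in> pverts G"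
    and "z \<in> set (tree_path G x y)"
  shows "z \<in> pverts G"
  using tree_path_props(1)[OF assms(1-3)] assms(4) by (auto simp: vpath_def vwalk_def)

section \<open>Ancestors and lowest common ancestors\<close>

lemma tree_path_suffix:
  assumes "undirected_tree G" and "x \<in> pverts G" and "y \<in> pverts G"
    and "tree_path G x y = A @ a # B"
  shows "tree_path G a y = a # B"
proof -
  note * = tree_path_props[OF assms(1-3), unfolded assms(4)]
  show ?thesis
    using *(1,3) assms(1) by (intro tree_path_eqI) (auto dest: vpath_appendD)
qed

text \<open>The path from \<open>a\<close> to \<open>r\<close> is the part of the path from
  \<open>b\<close> to \<open>r\<close> that starts at \<open>a\<close>. If it contains
  \<open>b\<close>, the head of the whole path, then by distinctness nothing precedes
  \<open>a\<close>.\<close>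

lemma ancestor_antisym:
  assumes "undirected_tree G" and "r \<in> pverts G" and "a \<in> pverts G" and "b \<in> pverts G"
    and "ancestor G r a b" and "ancestor G r b a"
  shows "a = b"
proof -
  obtain A B where p: "tree_path G b r = A @ a # B"
    using assms(5) unfolding ancestor_def by (metis split_list)
  have "b \<in> set (a # B)"
    using assms(6) tree_path_suffix[OF assms(1,4,2) p] by (simp add: ancestor_def)
  moreover have "hd (A @ a # B) = b" "distinct (A @ a # B)"
    using tree_path_props[OF assms(1,4,2)] by (auto simp: p vpath_def)
  ultimately show ?thesis by (cases A) auto
qed

text \<open>Two vertices that meet the description in \<open>LCA\<close> are ancestors of each
  other, so antisymmetry identifies them.\<close>

lemma LCA_eqI:
  assumes "undirected_tree G" and "u \<in> pverts G" and "r \<in> pverts G"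
    and "common_ancestor G r c u v"
    and "\<And>a. common_ancestor G r a u v \<Longrightarrow> ancestor G r a c"
  shows "LCA G u v r = c"
  unfolding LCA_def
proof (rule the_equality)
  show "common_ancestor G r c u v \<and> (\<forall>a. common_ancestor G r a u v \<longrightarrow> ancestor G r a c)"
    using assms by blast
next
  fix d
  assume d: "common_ancestor G r d u v \<and> (\<forall>a. common_ancestor G r a u v \<longrightarrow> ancestor G r a d)"
  \<comment> \<open>Antisymmetry speaks of vertices of the graph; common ancestors are such, as they
    lie on a tree path.\<close>
  then have "d \<in> pverts G" "c \<in> pverts G"
    using assms(4) tree_path_in_verts[OF assms(1-3)]
    unfolding common_ancestor_def ancestor_def by auto
  then show "d = c"
    using ancestor_antisym[OF assms(1,3)] d assms(4,5) by blast
qed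

text \<open>The LCA is the first vertex of the path from \<open>u\<close> to \<open>r\<close> that
  lies on the path from \<open>v\<close> to \<open>r\<close>. From there both continue as the unique
  path to \<open>r\<close>, whence the shared \<open>S\<close>.\<close>

lemma LCA_split:
  assumes "undirected_tree G" and "u \<in> pverts G" and "v \<in> pverts G" and "r \<in> pverts G"
  obtains A B S where "tree_path G u r = A @ LCA G u v r # S"
    and "tree_path G v r = B @ LCA G u v r # S" and "set A \<inter> set B = {}"
proof -
  note pu = tree_path_props[OF assms(1,2,4)] and pv = tree_path_props[OF assms(1,3,4)]
  have "\<exists>z\<in>set (tree_path G u r). z \<in> set (tree_path G v r)"
    using pu pv by (metis last_in_set)
  then obtain A c S where u: "tree_path G u r = A @ c # S"
    and c: "c \<in> set (tree_path G v r)" and A: "\<forall>y\<in>set A. y \<notin> set (tree_path G v r)"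
    by (rule split_list_first_propE)
  obtain B S' where v: "tree_path G v r = B @ c # S'" using c by (metis split_list)
  have cr: "tree_path G c r = c # S" by (rule tree_path_suffix[OF assms(1,2,4) u])
  have S': "S' = S" using tree_path_suffix[OF assms(1,3,4) v] cr by simp
  have "LCA G u v r = c"
    \<comment> \<open>A common ancestor is not in \<open>A\<close>, so it lies in
      \<open>c # S\<close>, the path from \<open>c\<close> to \<open>r\<close>.\<close>
    using A by (intro LCA_eqI[OF assms(1,2,4)])
      (auto simp: common_ancestor_def ancestor_def cr u v)
  then show thesis using that[of A S B] A by (auto simp: u v S')
qed

text \<open>The witness is a contiguous segment of \<open>p\<close> or of its reverse, depending on
  which of \<open>x\<close> and \<open>y\<close> comes first. It will be applied to chains.\<close>

lemma vpath_between_in_list: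
  assumes "symmetric G" and "vpath p G" and "x \<in> set p" and "y \<in> set p"
  obtains q where "vpath q G" and "hd q = x" and "last q = y" and "set q \<subseteq> set p"
proof -
  have segment: "\<exists>q. vpath q G \<and> hd q = x \<and> last q = y \<and> set q \<subseteq> set l"
    if l: "vpath l G" "l = A @ x # B" "y \<in> set (x # B)" for l A B
  proof -
    obtain C D where CD: "x # B = C @ y # D" using l(3) by (metis split_list)
    have "vpath (x # B) G" using l(1,2) vpath_appendD(2) by blast
    then have "vpath ((C @ [y]) @ D) G" by (simp add: CD)
    then have "vpath (C @ [y]) G" by (rule vpath_appendD) simp
    moreover have "hd (C @ [y]) = x" using CD by (cases C) auto
    moreover have "set (C @ [y]) \<subseteq> set l" using l(2) CD by auto
    ultimately show ?thesis by (intro exI[of _ "C @ [y]"]) simp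
  qed
  obtain A B where p: "p = A @ x # B" using assms(3) by (metis split_list)
  have "\<exists>q. vpath q G \<and> hd q = x \<and> last q = y \<and> set q \<subseteq> set p"
  proof (cases "y \<in> set (x # B)")
    case True
    then show ?thesis using segment[OF assms(2) p] by blast
  next
    case False
    \<comment> \<open>Now \<open>y\<close> precedes \<open>x\<close> in \<open>p\<close>, hence
      follows it in \<open>rev p\<close>, which is \<open>rev B @ x # rev A\<close>.\<close>
    then have "y \<in> set (x # rev A)" using assms(4) by (auto simp: p)
    then show ?thesis
      using segment[OF vpath_rev[OF assms(1,2)], of "rev B" "rev A"]
      by (simp add: p Un_commute)
  qed
  then show thesis using that by blast
qed

section \<open>Owners along paths of a ternarization\<close>

context
  fixes T T' :: "'a pair_pre_digraph" and owner :: "'a \<Rightarrow> 'a"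
  assumes tree: "undirected_tree T" and tern: "ternarization T T' owner"
begin

lemma ternarization_tree: "undirected_tree T'"
  using tern unfolding ternarization_def by (rule conjunct1)

lemma ternarization_chains:
  obtains chain att where
    "\<forall>v \<in> pverts T. distinct (chain v) \<and> v \<in> set (chain v) \<and>
        (\<forall>x \<in> set (chain v). owner x = v)"
    and "\<forall>v w. (v, w) \<in> parcs T \<longrightarrow> att v w \<in> set (chain v)"
    and "pverts T' = (\<Union>v \<in> pverts T. set (chain v))"
    and "parcs T' = (\<Union>v \<in> pverts T. symcl (set (vwalk_arcs (chain v)))) \<union>
        {(att v w, att w v) | v w. (v, w) \<in> parcs T}"
  using tern[unfolded ternarization_def, THEN conjunct2, THEN conjunct2]
  by (elim exE conjE) (rule that)

lemma ternarization_pverts: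
  shows "pverts T \<subseteq> pverts T'"
    and "v \<in> pverts T \<Longrightarrow> owner v = v"
    and "x \<in> pverts T' \<Longrightarrow> owner x \<in> pverts T"
proof -
  obtain chain where chain: "\<forall>v \<in> pverts T. distinct (chain v) \<and> v \<in> set (chain v) \<and>
        (\<forall>x \<in> set (chain v). owner x = v)"
    and verts: "pverts T' = (\<Union>v \<in> pverts T. set (chain v))"
    by (rule ternarization_chains) (rule that)
  show "pverts T \<subseteq> pverts T'" using chain verts by blast
  show "owner v = v" if "v \<in> pverts T" using chain that by blast
  show "owner x \<in> pverts T" if "x \<in> pverts T'" using chain verts that by auto
qed

text \<open>An arc of \<open>T'\<close> either runs inside one chain or carries an original
  edge.\<close>

lemma owner_arc:
  assumes "(x, y) \<in> parcs T'"
  shows "owner x = owner y \<or> (owner x, owner y) \<in> parcs T"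
proof -
  interpret pair_graph T using tree unfolding undirected_tree_def by simp
  obtain chain att where chain: "\<forall>v \<in> pverts T. distinct (chain v) \<and> v \<in> set (chain v) \<and>
        (\<forall>x \<in> set (chain v). owner x = v)"
    and att: "\<forall>v w. (v, w) \<in> parcs T \<longrightarrow> att v w \<in> set (chain v)"
    and arcs: "parcs T' = (\<Union>v \<in> pverts T. symcl (set (vwalk_arcs (chain v)))) \<union>
        {(att v w, att w v) | v w. (v, w) \<in> parcs T}"
    by (rule ternarization_chains) (rule that)
  consider v where "v \<in> pverts T" "(x, y) \<in> symcl (set (vwalk_arcs (chain v)))"
    | v w where "(v, w) \<in> parcs T" "x = att v w" "y = att w v"
    using assms unfolding arcs by blast
  then show ?thesis
  proof cases
    case 1
    then have "x \<in> set (chain v)" "y \<in> set (chain v)"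
      using arcs_in_vwalk_arcs by (force simp: symcl_def)+
    then show ?thesis using chain 1(1) by simp
  next
    case 2
    \<comment> \<open>The reversed arc is what places \<open>att w v\<close> in the chain of
      \<open>w\<close>.\<close>
    then have "(w, v) \<in> parcs T" "v \<in> pverts T" "w \<in> pverts T"
      using arcs_symmetric wellformed[of "(v, w)"] by auto
    then show ?thesis using 2 chain att by simp
  qed
qed

text \<open>The chain of the common owner is itself a path of \<open>T'\<close> through both ends of
  \<open>p\<close>. Its segment between them has a single owner and equals \<open>p\<close> by
  uniqueness of paths.\<close>

lemma owner_constant_on_vpath:
  assumes "vpath p (with_proj T')" and "owner (hd p) = owner (last p)" and "x \<in> set p"
  shows "owner x = owner (hd p)"
proof -
  obtain chain att where chain: "\<forall>v \<in> pverts T. distinct (chain v) \<and> v \<in> set (chain v) \<and>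
        (\<forall>x \<in> set (chain v). owner x = v)"
    and verts: "pverts T' = (\<Union>v \<in> pverts T. set (chain v))"
    and arcs: "parcs T' = (\<Union>v \<in> pverts T. symcl (set (vwalk_arcs (chain v)))) \<union>
        {(att v w, att w v) | v w. (v, w) \<in> parcs T}"
    by (rule ternarization_chains) (rule that)
  define v where "v = owner (hd p)"
  have "hd p \<in> pverts T'" "last p \<in> pverts T'"
    using assms(1) by (auto simp: vpath_def vwalk_def)
  then have v: "v \<in> pverts T" "hd p \<in> set (chain v)" "last p \<in> set (chain v)"
    using verts chain assms(2) by (auto simp: v_def)
  have "set (vwalk_arcs (chain v)) \<subseteq> parcs T'"
    unfolding arcs symcl_def using v(1) by blast
  moreover have "set (chain v) \<subseteq> pverts T'" and "distinct (chain v)" and "chain v \<noteq> []"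
    using chain verts v(1) by auto
  ultimately have "vpath (chain v) (with_proj T')"
    by (intro vpathI vwalkI) simp_all
  from undirected_tree_symmetric[OF ternarization_tree] this v(2,3)
  obtain q where q: "vpath q (with_proj T')" "hd q = hd p" "last q = last p"
      "set q \<subseteq> set (chain v)"
    by (rule vpath_between_in_list)
  then have "p = q"
    using undirected_tree_vpath_unique[OF ternarization_tree assms(1)] by simp
  then show ?thesis using chain v(1) q(4) assms(3) v_def by blast
qed

text \<open>Of the inner vertices of the projected path only the set is recorded, because
  \<open>ancestor\<close> asks for nothing but membership in a path.\<close>

lemma owner_vpath:
  assumes "vpath p (with_proj T')"
  shows "\<exists>q. vpath q (with_proj T) \<and> hd q = owner (hd p) \<and> last q = owner (last p) \<and>
    set q = owner ` set p"
  using assms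
proof (induction p)
  case Nil
  then show ?case by (simp add: vpath_def vwalk_def)
next
  case (Cons x p)
  show ?case
  proof (cases "p = []")
    case True
    then show ?thesis
      using Cons.prems ternarization_pverts(3)
      by (intro exI[of _ "[owner x]"]) (auto simp: vpath_def)
  next
    case False
    then obtain q where q: "vpath q (with_proj T)" "hd q = owner (hd p)"
        "last q = owner (last p)" "set q = owner ` set p"
      using Cons by (auto dest: vpath_ConsD)
    have qne: "q \<noteq> []" using q(1) by (auto simp: vpath_def vwalk_def)
    have x: "x \<in> pverts T'" "(x, hd p) \<in> parcs T'"
      using Cons.prems False by (auto simp: vpath_def vwalk_Cons_iff)
    show ?thesis
    proof (cases "owner x = owner (hd p)")
      case True
      then show ?thesis using q False by (intro exI[of _ q]) auto
    next
      case neq: False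
      \<comment> \<open>If the owner of \<open>x\<close> came back at some \<open>y\<close>, it
        would own the whole subpath from \<open>x\<close> to \<open>y\<close>. That subpath contains
        \<open>hd p\<close>, possibly as \<open>y\<close> itself, whose owner is different.\<close>
      have "owner x \<notin> set q"
      proof
        assume "owner x \<in> set q"
        then obtain y where "y \<in> set p" and y: "owner x = owner y" using q(4) by auto
        then obtain A B where p: "p = A @ y # B" by (metis split_list)
        have "vpath ((x # A @ [y]) @ B) (with_proj T')" using Cons.prems by (simp add: p)
        then have "vpath (x # A @ [y]) (with_proj T')" by (rule vpath_appendD) simp
        moreover have "hd p \<in> set (x # A @ [y])" by (cases A) (auto simp: p)
        ultimately show False
          using owner_constant_on_vpath[of "x # A @ [y]" "hd p"] y neq by simp
      qed
      then have "vpath (owner x # q) (with_proj T)"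
        using q(1,2) qne owner_arc[OF x(2)] neq ternarization_pverts(3)[OF x(1)]
        by (auto simp: vpath_def vwalk_Cons_iff)
      then show ?thesis
        using q False qne by (intro exI[of _ "owner x # q"]) auto
    qed
  qed
qed

lemma set_tree_path_owner:
  assumes "x \<in> pverts T'" and "y \<in> pverts T'"
  shows "set (tree_path T (owner x) (owner y)) = owner ` set (tree_path T' x y)"
proof -
  note p = tree_path_props[OF ternarization_tree assms]
  obtain q where q: "vpath q (with_proj T)" "hd q = owner x" "last q = owner y"
      "set q = owner ` set (tree_path T' x y)"
    using owner_vpath[OF p(1)] unfolding p(2,3) by blast
  then show ?thesis using tree_path_eqI[OF tree q(1-3)] by simp
qed

lemma owner_LCA:
  assumes "u \<in> pverts T" and "v \<in> pverts T" and "r \<in> pverts T"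
  shows "owner (LCA T' u v r) = LCA T u v r"
proof -
  define c where "c = LCA T' u v r"
  have in': "u \<in> pverts T'" "v \<in> pverts T'" "r \<in> pverts T'"
    using assms ternarization_pverts(1) by auto
  obtain A B S where u: "tree_path T' u r = A @ c # S" and v: "tree_path T' v r = B @ c # S"
    and AB: "set A \<inter> set B = {}"
    using LCA_split[OF ternarization_tree in'] unfolding c_def by metis
  have c_in: "c \<in> pverts T'"
    using tree_path_in_verts[OF ternarization_tree in'(1,3)] u by simp
  \<comment> \<open>\<open>u\<close>, \<open>v\<close> and \<open>r\<close> are their own owners, so
    the projected paths have the original end vertices.\<close>
  have ur: "set (tree_path T u r) = owner ` set (A @ c # S)"
    using set_tree_path_owner[OF in'(1,3)] ternarization_pverts(2) assms u by simp
  have vr: "set (tree_path T v r) = owner ` set (B @ c # S)"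
    using set_tree_path_owner[OF in'(2,3)] ternarization_pverts(2) assms v by simp
  have cr: "set (tree_path T (owner c) r) = owner ` set (c # S)"
    using set_tree_path_owner[OF c_in in'(3)] ternarization_pverts(2) assms(3)
      tree_path_suffix[OF ternarization_tree in'(1,3) u] by simp
  have "LCA T u v r = owner c"
  proof (rule LCA_eqI[OF tree assms(1,3)])
    show "common_ancestor T r (owner c) u v"
      using ur vr by (simp add: common_ancestor_def ancestor_def)
  next
    fix a assume "common_ancestor T r a u v"
    then have a: "a \<in> owner ` set (A @ c # S)" "a \<in> owner ` set (B @ c # S)"
      using ur vr by (auto simp: common_ancestor_def ancestor_def)
    have "a \<in> owner ` set (c # S)"
    proof (rule ccontr)
      assume not: "a \<notin> owner ` set (c # S)"
      then obtain x y where x: "x \<in> set A" "a = owner x" and y: "y \<in> set B" "a = owner y"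
        using a by auto
      obtain A1 A2 where A: "A = A1 @ x # A2" using x(1) by (metis split_list)
      obtain B1 B2 where B: "B = B1 @ y # B2" using y(1) by (metis split_list)
      \<comment> \<open>Together these lead from \<open>x\<close> forward to \<open>c\<close> and
        then backward to \<open>y\<close>. The vertex \<open>c\<close> is put into \<open>?q\<close>
        only, so that the concatenation does not repeat it.\<close>
      let ?p = "x # A2" and ?q = "c # rev (y # B2)"
      have "vpath (A1 @ (?p @ [c]) @ S) (with_proj T')"
        using tree_path_props(1)[OF ternarization_tree in'(1,3)] by (simp add: u A)
      then have "vpath ((?p @ [c]) @ S) (with_proj T')" by (rule vpath_appendD) simp
      then have p: "vpath (?p @ [c]) (with_proj T')" by (rule vpath_appendD) simp
      have "vpath (B1 @ ((y # B2) @ [c]) @ S) (with_proj T')"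
        using tree_path_props(1)[OF ternarization_tree in'(2,3)] by (simp add: v B)
      then have "vpath (((y # B2) @ [c]) @ S) (with_proj T')" by (rule vpath_appendD) simp
      then have "vpath ((y # B2) @ [c]) (with_proj T')" by (rule vpath_appendD) simp
      from vpath_rev[OF undirected_tree_symmetric[OF ternarization_tree] this]
      have q: "vpath ?q (with_proj T')" by simp
      have "vpath (?p @ ?q) (with_proj T')"
      proof (rule vpathI)
        have "vwalk (?p @ [c]) (with_proj T')" and "vwalk ?q (with_proj T')"
          using p q by (simp_all only: vpath_def)
        then show "vwalk (?p @ ?q) (with_proj T')"
          by (simp only: vwalk_append_iff list.sel list.simps not_False_eq_True)
        \<comment> \<open>\<open>A\<close> and \<open>B\<close> are disjoint by the choice of the
          split, and \<open>c\<close> occurs in neither since both paths to \<open>r\<close> are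
          repetition-free.\<close>
        show "distinct (?p @ ?q)"
          using p q AB by (auto simp: vpath_def A B)
      qed
      moreover have "hd (?p @ ?q) = x" and "last (?p @ ?q) = y" and "c \<in> set (?p @ ?q)"
        by simp_all
      \<comment> \<open>Both ends are owned by \<open>a\<close>, so every vertex in between is, in
        particular \<open>c\<close>, the head of \<open>c # S\<close>.\<close>
      ultimately have "owner c = a"
        using owner_constant_on_vpath x(2) y(2) by metis
      then show False using not by simp
    qed
    then show "ancestor T r a (owner c)" using cr by (simp add: ancestor_def)
  qed
  then show ?thesis by (simp add: c_def)
qed

end

theorem theorem4p7:
  fixes T T' :: "'a pair_pre_digraph" and owner :: "'a \<Rightarrow> 'a" and u v r :: 'a
  assumes "undirected_tree T"
    and "ternarization T T' owner"
    and "u \<in> pverts T" and "v \<in> pverts T" and "r \<in> pverts T"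
  shows "owner (LCA T' u v r) = LCA T u v r"
  using assms by (rule owner_LCA)

end
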